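(* Let $X_N,Y_N$ be random vectors taking values in $\mathcal X\subset\mathbb R^k$ with $\|X_N-Y_N\|_2=o_p(1)$, and let $f:\mathcal X\to\mathbb R$ be uniformly continuous on $\mathcal X$ and bounded, $\sup_{x\in\mathcal X}|f(x)|<\infty$. Then $\mathbb E[|f(X_N)-f(Y_N)|]\to0$. Moreover, for any sequence of $\sigma$-algebras $\mathcal F_N$, $\mathbb E[|f(X_N)-f(Y_N)|\mid\mathcal F_N]\xrightarrow{p}0$.
   Context: All limits are as $N\to\infty$; $\xrightarrow{p}$ denotes convergence in probability. *)

theory Defs
  imports "HOL-Probability.Probability"
begin

text \<open>
  The limit is a constant, so the \<open>N\<close>-th variable may live on its own probability space
  \<open>M N\<close>; a single common space is the case of constant \<open>M\<close>. Measurability is part of the notion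
  because \<^const>\<open>measure\<close> assigns 0 to non-measurable sets.
\<close>

definition tendsto_in_prob ::
  "(nat \<Rightarrow> 'w measure) \<Rightarrow> (nat \<Rightarrow> 'w \<Rightarrow> 'b::metric_space) \<Rightarrow> 'b \<Rightarrow> bool" where
  "tendsto_in_prob M Z c \<longleftrightarrow>
     (\<forall>N. Z N \<in> borel_measurable (M N)) \<and>
     (\<forall>\<epsilon>>0. (\<lambda>N. measure (M N) {\<omega> \<in> space (M N). dist (Z N \<omega>) c > \<epsilon>}) \<longlonglongrightarrow> 0)"

end

theory Submission
  imports Defs
begin

text \<open>
  Let \<open>D\<^sub>N = \<bar>f (X\<^sub>N) - f (Y\<^sub>N)\<bar>\<close>. Uniform continuity turns a small distance
  between \<open>X\<^sub>N\<close> and \<open>Y\<^sub>N\<close> into a small \<open>D\<^sub>N\<close>, with a modulus that depends neither on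
  the point nor on \<open>N\<close>; hence \<open>D\<^sub>N \<rightarrow> 0\<close> in probability
  (\<open>tendsto_in_prob_uniformly_continuous\<close>). Since \<open>f\<close> is bounded, so is \<open>D\<^sub>N\<close>, uniformly in \<open>N\<close>,
  and a bounded sequence that vanishes in probability vanishes in mean
  (\<open>expectation_tendsto_0_of_tendsto_in_prob\<close>).

  Conditioning preserves expectations and nonnegativity. The conditional expectation of \<open>D\<^sub>N\<close> is
  therefore an almost surely nonnegative variable whose mean tends to \<open>0\<close>, whichever
  \<open>\<sigma>\<close>-algebras are used, and Markov's inequality gives convergence in probability
  (\<open>tendsto_in_prob_0_of_expectation\<close>).
\<close>

text \<open>
  The set \<open>S\<close> need not be Borel, so \<open>f\<close>, even after extension by zero, need not be Borel measurable.
  Measurability of the composition comes from factoring \<open>X\<close> through the trace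
  \<open>\<sigma>\<close>-algebra on \<open>S\<close>.
\<close>

lemma borel_measurable_continuous_on_compose:
  fixes f :: "'a::topological_space \<Rightarrow> 'b::topological_space"
  assumes "continuous_on S f" "X \<in> borel_measurable M" "\<And>\<omega>. \<omega> \<in> space M \<Longrightarrow> X \<omega> \<in> S"
  shows "(\<lambda>\<omega>. f (X \<omega>)) \<in> borel_measurable M"
proof -
  have "X \<in> measurable M (restrict_space borel S)"
    using assms(2,3) by (intro measurable_restrict_space2) auto
  moreover have "f \<in> borel_measurable (restrict_space borel S)"
    using assms(1) by (rule borel_measurable_continuous_on_restrict)
  ultimately show ?thesis
    by (rule measurable_compose)
qed

lemma tendsto_in_prob_uniformly_continuous:
  fixes X Y :: "nat \<Rightarrow> 'w \<Rightarrow> 'a::real_normed_vector" and f :: "'a \<Rightarrow> real"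
  assumes M: "\<And>N. prob_space (M N)"
    and X: "\<And>N. X N \<in> borel_measurable (M N)" "\<And>N \<omega>. \<omega> \<in> space (M N) \<Longrightarrow> X N \<omega> \<in> S"
    and Y: "\<And>N. Y N \<in> borel_measurable (M N)" "\<And>N \<omega>. \<omega> \<in> space (M N) \<Longrightarrow> Y N \<omega> \<in> S"
    and lim: "tendsto_in_prob M (\<lambda>N \<omega>. norm (X N \<omega> - Y N \<omega>)) 0"
    and f: "uniformly_continuous_on S f"
  shows "tendsto_in_prob M (\<lambda>N \<omega>. \<bar>f (X N \<omega>) - f (Y N \<omega>)\<bar>) 0"
  unfolding tendsto_in_prob_def
proof (intro conjI allI impI)
  note cont = uniformly_continuous_imp_continuous[OF f]
  show "(\<lambda>\<omega>. \<bar>f (X N \<omega>) - f (Y N \<omega>)\<bar>) \<in> borel_measurable (M N)" for N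
    using borel_measurable_continuous_on_compose[OF cont X(1) X(2)]
      borel_measurable_continuous_on_compose[OF cont Y(1) Y(2)]
    by measurable
  fix \<epsilon> :: real assume "\<epsilon> > 0"
  then obtain \<delta> where "\<delta> > 0"
    and \<delta>: "\<And>x y. x \<in> S \<Longrightarrow> y \<in> S \<Longrightarrow> dist y x < \<delta> \<Longrightarrow> dist (f y) (f x) < \<epsilon>"
    using f unfolding uniformly_continuous_on_def by metis
  \<comment> \<open>Failure of \<open>\<dots> < \<delta>\<close> yields only \<open>\<delta> \<le> \<dots>\<close>, whereas convergence in probability
    controls strict exceedance; hence the threshold \<open>\<delta> / 2\<close>.\<close>
  let ?far = "\<lambda>N. {\<omega> \<in> space (M N). dist (norm (X N \<omega> - Y N \<omega>)) 0 > \<delta> / 2}"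
  have far: "(\<lambda>N. measure (M N) (?far N)) \<longlonglongrightarrow> 0"
    using lim half_gt_zero[OF \<open>\<delta> > 0\<close>] unfolding tendsto_in_prob_def by blast
  have dist_meas: "(\<lambda>\<omega>. norm (X N \<omega> - Y N \<omega>)) \<in> borel_measurable (M N)" for N
    using lim unfolding tendsto_in_prob_def by blast
  have "measure (M N) {\<omega> \<in> space (M N). dist \<bar>f (X N \<omega>) - f (Y N \<omega>)\<bar> 0 > \<epsilon>}
      \<le> measure (M N) (?far N)" for N
  proof -
    interpret prob_space "M N" by (rule M)
    have "?far N \<in> sets (M N)"
      using dist_meas[of N] by measurable
    moreover have "{\<omega> \<in> space (M N). dist \<bar>f (X N \<omega>) - f (Y N \<omega>)\<bar> 0 > \<epsilon>} \<subseteq> ?far N"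
    proof safe
      fix \<omega> assume \<omega>: "\<omega> \<in> space (M N)" "dist \<bar>f (X N \<omega>) - f (Y N \<omega>)\<bar> 0 > \<epsilon>"
      then have "\<not> dist (X N \<omega>) (Y N \<omega>) < \<delta>"
        using \<delta>[OF Y(2)[OF \<omega>(1)] X(2)[OF \<omega>(1)]] by (auto simp: dist_real_def)
      then show "dist (norm (X N \<omega> - Y N \<omega>)) 0 > \<delta> / 2"
        using \<open>\<delta> > 0\<close> by (simp add: dist_norm)
    qed
    ultimately show ?thesis
      by (intro finite_measure_mono)
  qed
  then show "(\<lambda>N. measure (M N) {\<omega> \<in> space (M N). dist \<bar>f (X N \<omega>) - f (Y N \<omega>)\<bar> 0 > \<epsilon>})
      \<longlonglongrightarrow> 0"
    by (intro tendsto_sandwich[OF _ _ tendsto_const far] always_eventually allI measure_nonneg)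
qed

text \<open>
  Splitting the expectation at level \<open>\<epsilon>\<close> bounds it by \<open>\<epsilon> + B \<cdot> P(\<bar>Z\<^sub>N\<bar> > \<epsilon>)\<close>. This replaces
  dominated convergence, which has no meaning across varying probability spaces.
\<close>

lemma expectation_tendsto_0_of_tendsto_in_prob:
  fixes Z :: "nat \<Rightarrow> 'w \<Rightarrow> real"
  assumes M: "\<And>N. prob_space (M N)"
    and lim: "tendsto_in_prob M Z 0"
    and bound: "\<And>N \<omega>. \<omega> \<in> space (M N) \<Longrightarrow> \<bar>Z N \<omega>\<bar> \<le> B"
  shows "(\<lambda>N. prob_space.expectation (M N) (Z N)) \<longlonglongrightarrow> 0"
proof (rule LIMSEQ_I)
  fix r :: real assume "r > 0"
  define big where "big N = {\<omega> \<in> space (M N). dist (Z N \<omega>) 0 > r / 2}" for N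
  have meas: "Z N \<in> borel_measurable (M N)" for N
    using lim unfolding tendsto_in_prob_def by blast
  have big_sets: "big N \<in> sets (M N)" for N
    unfolding big_def using meas[of N] by measurable
  have "(\<lambda>N. measure (M N) (big N)) \<longlonglongrightarrow> 0"
    using lim half_gt_zero[OF \<open>r > 0\<close>] unfolding tendsto_in_prob_def big_def by blast
  then have "(\<lambda>N. r / 2 + B * measure (M N) (big N)) \<longlonglongrightarrow> r / 2 + B * 0"
    by (intro tendsto_intros)
  then have "\<forall>\<^sub>F N in sequentially. r / 2 + B * measure (M N) (big N) < r"
    using \<open>r > 0\<close> by (elim order_tendstoD(2)) simp
  moreover have "\<bar>\<integral>\<omega>. Z N \<omega> \<partial>M N\<bar> \<le> r / 2 + B * measure (M N) (big N)" for N
  proof -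
    interpret prob_space "M N" by (rule M)
    have "integrable (M N) (Z N)"
      using meas bound by (intro integrable_const_bound[where B = B]) auto
    then have "\<bar>\<integral>\<omega>. Z N \<omega> \<partial>M N\<bar> \<le> (\<integral>\<omega>. \<bar>Z N \<omega>\<bar> \<partial>M N)"
      by simp
    also have "\<dots> \<le> (\<integral>\<omega>. r / 2 + B * indicator (big N) \<omega> \<partial>M N)"
    proof (rule integral_mono)
      show "integrable (M N) (\<lambda>\<omega>. \<bar>Z N \<omega>\<bar>)"
        using \<open>integrable (M N) (Z N)\<close> by simp
      show "integrable (M N) (\<lambda>\<omega>. r / 2 + B * indicator (big N) \<omega>)"
        using big_sets[of N] by (simp add: less_top[symmetric])
      show "\<bar>Z N \<omega>\<bar> \<le> r / 2 + B * indicator (big N) \<omega>" if "\<omega> \<in> space (M N)" for \<omega>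
        using bound[OF that] that \<open>r > 0\<close> by (auto simp: big_def indicator_def)
    qed
    also have "\<dots> = r / 2 + B * measure (M N) (big N)"
      using big_sets[of N] by (simp add: prob_space less_top[symmetric])
    finally show ?thesis .
  qed
  ultimately have "\<forall>\<^sub>F N in sequentially. norm ((\<integral>\<omega>. Z N \<omega> \<partial>M N) - 0) < r"
    by (auto elim!: eventually_mono intro: order.strict_trans1)
  then show "\<exists>n\<^sub>0. \<forall>N\<ge>n\<^sub>0. norm ((\<integral>\<omega>. Z N \<omega> \<partial>M N) - 0) < r"
    by (simp add: eventually_sequentially)
qed

text \<open>
  Nonnegativity is required only almost surely: a conditional expectation is determined
  only up to a null set.
\<close>

lemma tendsto_in_prob_0_of_expectation:
  fixes Z :: "nat \<Rightarrow> 'w \<Rightarrow> real"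
  assumes M: "\<And>N. prob_space (M N)"
    and int: "\<And>N. integrable (M N) (Z N)"
    and nonneg: "\<And>N. AE \<omega> in M N. 0 \<le> Z N \<omega>"
    and lim: "(\<lambda>N. prob_space.expectation (M N) (Z N)) \<longlonglongrightarrow> 0"
  shows "tendsto_in_prob M Z 0"
  unfolding tendsto_in_prob_def
proof (intro conjI allI impI)
  show "Z N \<in> borel_measurable (M N)" for N
    using int by (rule borel_measurable_integrable)
  fix \<epsilon> :: real assume "\<epsilon> > 0"
  have markov: "measure (M N) {\<omega> \<in> space (M N). dist (Z N \<omega>) 0 > \<epsilon>}
      \<le> (\<integral>\<omega>. Z N \<omega> \<partial>M N) / \<epsilon>" for N
  proof -
    interpret prob_space "M N" by (rule M)
    have [measurable]: "Z N \<in> borel_measurable (M N)"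
      using int by (rule borel_measurable_integrable)
    have "measure (M N) {\<omega> \<in> space (M N). dist (Z N \<omega>) 0 > \<epsilon>}
        \<le> measure (M N) {\<omega> \<in> space (M N). \<epsilon> \<le> Z N \<omega>}"
      using nonneg[of N] by (intro finite_measure_mono_AE) (auto elim!: eventually_mono)
    also have "\<dots> \<le> (\<integral>\<omega>. Z N \<omega> \<partial>M N) / \<epsilon>"
      using int nonneg \<open>\<epsilon> > 0\<close> by (intro integral_Markov_inequality_measure[where A = "{}"]) auto
    finally show ?thesis .
  qed
  have "(\<lambda>N. (\<integral>\<omega>. Z N \<omega> \<partial>M N) / \<epsilon>) \<longlonglongrightarrow> 0"
    using tendsto_divide[OF lim tendsto_const, of \<epsilon>] \<open>\<epsilon> > 0\<close> by simp
  then show "(\<lambda>N. measure (M N) {\<omega> \<in> space (M N). dist (Z N \<omega>) 0 > \<epsilon>}) \<longlonglongrightarrow> 0"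
    by (rule tendsto_sandwich[OF _ _ tendsto_const, rotated 2])
      (use markov in \<open>auto intro!: always_eventually\<close>)
qed

theorem lemmaS14:
  fixes M :: "nat \<Rightarrow> 'w measure"
    and X Y :: "nat \<Rightarrow> 'w \<Rightarrow> real ^ 'k"
    and S :: "(real ^ 'k) set"
    and f :: "real ^ 'k \<Rightarrow> real"
  assumes "\<And>N. prob_space (M N)"
    and "\<And>N. X N \<in> borel_measurable (M N)"
    and "\<And>N. Y N \<in> borel_measurable (M N)"
    and "\<And>N \<omega>. \<omega> \<in> space (M N) \<Longrightarrow> X N \<omega> \<in> S"
    and "\<And>N \<omega>. \<omega> \<in> space (M N) \<Longrightarrow> Y N \<omega> \<in> S"
    and "tendsto_in_prob M (\<lambda>N \<omega>. norm (X N \<omega> - Y N \<omega>)) 0"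
    and "uniformly_continuous_on S f"
    and "bounded (f ` S)"
  shows "(\<lambda>N. prob_space.expectation (M N) (\<lambda>\<omega>. \<bar>f (X N \<omega>) - f (Y N \<omega>)\<bar>)) \<longlonglongrightarrow> 0 \<and>
    (\<forall>F :: nat \<Rightarrow> 'w measure. (\<forall>N. subalgebra (M N) (F N)) \<longrightarrow>
      tendsto_in_prob M
        (\<lambda>N. real_cond_exp (M N) (F N) (\<lambda>\<omega>. \<bar>f (X N \<omega>) - f (Y N \<omega>)\<bar>)) 0)"
proof -
  note M = assms(1)
  let ?D = "\<lambda>N \<omega>. \<bar>f (X N \<omega>) - f (Y N \<omega>)\<bar>"
  have D_prob: "tendsto_in_prob M ?D 0"
    using assms(1-7) by (intro tendsto_in_prob_uniformly_continuous[where S = S])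
  obtain B where B: "\<And>x. x \<in> S \<Longrightarrow> \<bar>f x\<bar> \<le> B"
    using assms(8) by (auto simp: bounded_iff)
  have D_bound: "\<bar>?D N \<omega>\<bar> \<le> 2 * B" if "\<omega> \<in> space (M N)" for N \<omega>
    using B[OF assms(4)[OF that]] B[OF assms(5)[OF that]] by linarith
  have D_mean: "(\<lambda>N. prob_space.expectation (M N) (?D N)) \<longlonglongrightarrow> 0"
    using M D_prob D_bound by (rule expectation_tendsto_0_of_tendsto_in_prob)
  have D_meas: "?D N \<in> borel_measurable (M N)" for N
    using D_prob unfolding tendsto_in_prob_def by blast
  have D_int: "integrable (M N) (?D N)" for N
  proof -
    interpret prob_space "M N" by (rule M)
    show ?thesis
      using D_meas D_bound by (intro integrable_const_bound[where B = "2 * B"]) auto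
  qed
  have "tendsto_in_prob M (\<lambda>N. real_cond_exp (M N) (F N) (?D N)) 0"
    if F: "\<And>N. subalgebra (M N) (F N)" for F :: "nat \<Rightarrow> 'w measure"
  proof -
    have sub: "sigma_finite_subalgebra (M N) (F N)" for N
    proof -
      interpret prob_space "M N" by (rule M)
      interpret finite_measure_subalgebra "M N" "F N"
        using F by unfold_locales
      show ?thesis by unfold_locales
    qed
    show ?thesis
    proof (rule tendsto_in_prob_0_of_expectation[OF M])
      show "integrable (M N) (real_cond_exp (M N) (F N) (?D N))" for N
        using sub D_int by (rule sigma_finite_subalgebra.real_cond_exp_int)
      show "AE \<omega> in M N. 0 \<le> real_cond_exp (M N) (F N) (?D N) \<omega>" for N
        using D_meas by (intro sigma_finite_subalgebra.real_cond_exp_pos[OF sub]) auto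
      show "(\<lambda>N. \<integral>\<omega>. real_cond_exp (M N) (F N) (?D N) \<omega> \<partial>M N) \<longlonglongrightarrow> 0"
        using D_mean by (simp add: sigma_finite_subalgebra.real_cond_exp_int(2)[OF sub D_int])
    qed
  qed
  with D_mean show ?thesis
    by blast
qed

end
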